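(* Let $\{P^{(m)}\}_{m\ge1}$ be a sequence of empirical (uniform) probability measures on $\mathbb{S}^2$, $P^{(m)}=\frac1M\sum_{i=1}^M\delta_{x_i^{(m)}}$, whose supports $X^{(m)}=\{x_1^{(m)},\dots,x_M^{(m)}\}$ converge to $X=\{x_1,\dots,x_M\}\subset\mathbb{S}^2$ in the sense that $$\varepsilon_m:=\max_{1\le i\le M}d_G\bigl(x_i^{(m)},x_i\bigr)\longrightarrow0\quad\text{as }m\to\infty.$$ Let $P=\frac1M\sum_{i=1}^M\delta_{x_i}$ denote the limiting empirical measure. Then, for every fixed $n\ge1$: (1) The optimal distortion values converge: $V_{n,2}(P^{(m)})\to V_{n,2}(P)$ as $m\to\infty$. (2) Let $Q^{(m),*}$ be an optimal set of $n$-means for $P^{(m)}$. Then, after possibly reordering the points in each $Q^{(m),*}$, one can extract a subsequence that converges to a limiting set $Q^*$, and this limiting set $Q^*$ is an optimal set of $n$-means for $P$.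
   Context: $\mathbb{S}^2$ is the unit sphere in $\mathbb{R}^3$ with geodesic distance $d_G(x,y)=\arccos\langle x,y\rangle$. For $P=\frac1M\sum_{i=1}^M\delta_{x_i}$ and finite nonempty $Q\subset\mathbb{S}^2$, $V_{n,2}(P;Q)=\frac1M\sum_{i=1}^M\min_{q\in Q}d_G(x_i,q)^2$, and $V_{n,2}(P)=\inf\{V_{n,2}(P;Q):Q\subset\mathbb{S}^2,\ 1\le|Q|\le n\}$; an optimal set of $n$-means for $P$ is a $Q^*\subset\mathbb{S}^2$ with $1\le|Q^*|\le n$ and $V_{n,2}(P;Q^* )=V_{n,2}(P)$. Convergence of configurations means convergence in $(\mathbb{S}^2)^n$ of the configurations written as ordered $n$-tuples (padded with repetitions if a configuration has fewer than $n$ points); the limiting set is the set of entries of the limiting tuple. *)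

theory Defs
  imports "HOL-Probability.Probability"
begin

abbreviation S2 :: "(real ^ 3) set" where
  "S2 \<equiv> sphere 0 1"

definition geodesic_dist :: "real ^ 3 \<Rightarrow> real ^ 3 \<Rightarrow> real" where
  "geodesic_dist x y = arccos (x \<bullet> y)"

text \<open>The measure with mass 1/M at each of the points x 1, ..., x M, which need not be
  distinct (masses of coinciding points add up).  Only meaningful for M at least 1.\<close>

definition empirical :: "nat \<Rightarrow> (nat \<Rightarrow> real ^ 3) \<Rightarrow> (real ^ 3) pmf" where
  "empirical M x = map_pmf x (pmf_of_set {1..M})"

definition distortion :: "(real ^ 3) pmf \<Rightarrow> (real ^ 3) set \<Rightarrow> real" where
  "distortion P Q =
     measure_pmf.expectation P (\<lambda>p. Min ((\<lambda>q. (geodesic_dist p q)\<^sup>2) ` Q))"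

text \<open>For empirical measures this is the usual average over the sample.\<close>

lemma distortion_empirical:
  assumes "M \<ge> 1"
  shows "distortion (empirical M x) Q =
     1 / real M * (\<Sum>i=1..M. Min ((\<lambda>q. (geodesic_dist (x i) q)\<^sup>2) ` Q))"
  using assms
  by (simp add: distortion_def empirical_def integral_pmf_of_set)

definition config :: "nat \<Rightarrow> (real ^ 3) set \<Rightarrow> bool" where
  "config n Q \<longleftrightarrow> Q \<subseteq> S2 \<and> finite Q \<and> 1 \<le> card Q \<and> card Q \<le> n"

definition opt_distortion :: "nat \<Rightarrow> (real ^ 3) pmf \<Rightarrow> real" where
  "opt_distortion n P = Inf {distortion P Q | Q. config n Q}"

definition optimal_n_means :: "nat \<Rightarrow> (real ^ 3) pmf \<Rightarrow> (real ^ 3) set \<Rightarrow> bool" where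
  "optimal_n_means n P Q \<longleftrightarrow> config n Q \<and> distortion P Q = opt_distortion n P"

text \<open>An n-tuple of points of the sphere is a function read only on the indices 1, ..., n.
  It lists the set Q, in some order, exactly when its entries are the points of Q;
  repetitions serve as padding if Q has fewer than n points.\<close>

definition lists_config :: "nat \<Rightarrow> (nat \<Rightarrow> real ^ 3) \<Rightarrow> (real ^ 3) set \<Rightarrow> bool" where
  "lists_config n t Q \<longleftrightarrow> t ` {1..n} = Q"

text \<open>Convergence in the n-fold product of the sphere, i.e. entrywise in the geodesic distance.\<close>

definition tuple_converges ::
  "nat \<Rightarrow> (nat \<Rightarrow> nat \<Rightarrow> real ^ 3) \<Rightarrow> (nat \<Rightarrow> real ^ 3) \<Rightarrow> bool" where
  "tuple_converges n t l \<longleftrightarrow>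
     (\<forall>j\<in>{1..n}. l j \<in> S2 \<and> (\<lambda>k. geodesic_dist (t k j) (l j)) \<longlonglongrightarrow> 0)"

end

theory Submission
  imports Defs
begin

text \<open>The squared geodesic distance is uniformly continuous on the compact set
  \<open>S2 \<times> S2\<close>, so the distortion, as a function of the sample and of the tuple of centres, is
  uniformly continuous as well.  Uniformity in the centres lets the limit pass through the infimum,
  which is (1).  For (2), compactness gives a convergent subsequence of optimal tuples; along it the
  distortions converge both to the distortion of the limiting tuple and, by (1), to the optimal
  value.  This avoids the triangle inequality for the geodesic distance altogether.\<close>

section \<open>Stability of minima and infima under uniform perturbation\<close>

text \<open>A minimiser of either function is a competitor for the other and costs at most
  \<open>e\<close> more there. The minimisers themselves may differ.\<close>

lemma Min_image_diff_le:
  fixes f g :: "'a \<Rightarrow> real"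
  assumes "finite I" "I \<noteq> {}" and close: "\<And>i. i \<in> I \<Longrightarrow> \<bar>f i - g i\<bar> \<le> e"
  shows "\<bar>Min (f ` I) - Min (g ` I)\<bar> \<le> e"
proof -
  \<comment> \<open>Only one inequality is proved, with \<open>f\<close> and \<open>g\<close>
    generalised so that it can be used again with their roles exchanged.\<close>
  have "Min (f ` I) \<le> Min (g ` I) + e"
    if fg: "\<And>i. i \<in> I \<Longrightarrow> \<bar>f i - g i\<bar> \<le> e" for f g :: "'a \<Rightarrow> real"
  proof -
    have "Min (g ` I) \<in> g ` I"
      using assms by (intro Min_in) auto
    then obtain i where i: "i \<in> I" "Min (g ` I) = g i"
      by auto
    have "Min (f ` I) \<le> f i"
      using i assms by (intro Min_le) auto
    then show ?thesis
      using fg[OF i(1)] i(2) by linarith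
  qed
  from this[of f g] this[of g f] show ?thesis
    using close by (smt (verit))
qed

text \<open>No minimiser need exist here, so the infimum of one function, lowered by
  \<open>e\<close>, is shown to be a lower bound of the other. Boundedness below makes each real
  infimum a genuine lower bound.\<close>

lemma cINF_diff_le:
  fixes f g :: "'a \<Rightarrow> real"
  assumes "A \<noteq> {}" "bdd_below (f ` A)" "bdd_below (g ` A)"
    and close: "\<And>a. a \<in> A \<Longrightarrow> \<bar>f a - g a\<bar> \<le> e"
  shows "\<bar>(INF a\<in>A. f a) - (INF a\<in>A. g a)\<bar> \<le> e"
proof -
  have "(INF a\<in>A. f a) - e \<le> (INF a\<in>A. g a)"
    if "bdd_below (f ` A)" and fg: "\<And>a. a \<in> A \<Longrightarrow> \<bar>f a - g a\<bar> \<le> e" for f g :: "'a \<Rightarrow> real"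
  proof (rule cINF_greatest[OF \<open>A \<noteq> {}\<close>])
    fix a assume a: "a \<in> A"
    show "(INF a\<in>A. f a) - e \<le> g a"
      using cINF_lower[OF that(1) a] fg[OF a] by linarith
  qed
  from this[of f g] this[of g f] show ?thesis
    using assms by (smt (verit))
qed

section \<open>Simultaneous convergent subsequences\<close>

text \<open>Induction over the index set: each new index costs one further extraction, and limits
  already obtained survive it.\<close>

lemma seq_compact_finite_family:
  fixes t :: "nat \<Rightarrow> 'i \<Rightarrow> 'a::topological_space"
  assumes "finite J" "seq_compact S" "\<And>k j. j \<in> J \<Longrightarrow> t k j \<in> S"
  shows "\<exists>r l. strict_mono r \<and> (\<forall>j\<in>J. l j \<in> S \<and> (\<lambda>k. t (r k) j) \<longlonglongrightarrow> l j)"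
  using assms(1,3)
proof (induction J)
  case empty
  show ?case
    using strict_mono_id by blast
next
  case (insert a J)
  then obtain r l where r: "strict_mono r"
    and l: "\<And>j. j \<in> J \<Longrightarrow> l j \<in> S \<and> (\<lambda>k. t (r k) j) \<longlonglongrightarrow> l j"
    by (metis insertCI)
  have "\<forall>k. t (r k) a \<in> S"
    using insert.prems by simp
  then obtain la r' where la: "la \<in> S" and r': "strict_mono r'"
    and lim: "((\<lambda>k. t (r k) a) \<circ> r') \<longlonglongrightarrow> la"
    using seq_compactE[OF assms(2)] by metis
  \<comment> \<open>Since \<open>a\<close> is not in \<open>J\<close>, the update at
    \<open>a\<close> leaves the limits for \<open>J\<close> untouched.\<close>
  have "(\<lambda>k. t ((r \<circ> r') k) j) \<longlonglongrightarrow> (l(a := la)) j" if "j \<in> insert a J" for j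
    using lim LIMSEQ_subseq_LIMSEQ[OF conjunct2[OF l] r', of j] that insert.hyps
    by (auto simp: o_def)
  then show ?case
    using l la strict_mono_o[OF r r', unfolded o_def]
    by (intro exI[of _ "r \<circ> r'"] exI[of _ "l(a := la)"]) auto
qed

section \<open>Geodesic and Euclidean distance on the sphere\<close>

lemma S2_inner_bounds:
  assumes "p \<in> S2" "q \<in> S2"
  shows "p \<bullet> q \<in> {-1..1}"
  using Cauchy_Schwarz_ineq2[of p q] assms by auto

lemma geodesic_dist_nonneg: "p \<in> S2 \<Longrightarrow> q \<in> S2 \<Longrightarrow> 0 \<le> geodesic_dist p q"
  using S2_inner_bounds[of p q] by (auto simp: geodesic_dist_def intro: arccos_lbound)

lemma continuous_on_geodesic_dist:
  "continuous_on (S2 \<times> S2) (\<lambda>(p, q). geodesic_dist p q)"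
proof -
  \<comment> \<open>\<open>arccos\<close> is continuous on [-1, 1], and Cauchy-Schwarz keeps the
    inner product of unit vectors there.\<close>
  have "continuous_on (S2 \<times> S2) (\<lambda>z. arccos (fst z \<bullet> snd z))"
    using S2_inner_bounds
    by (intro continuous_intros) force+
  then show ?thesis
    by (simp add: geodesic_dist_def case_prod_beta)
qed

text \<open>The law of cosines for the chord. It recovers the Euclidean distance from the geodesic
  one by continuous functions.\<close>

lemma dist_S2_conv_geodesic_dist:
  assumes "p \<in> S2" "q \<in> S2"
  shows "(dist p q)\<^sup>2 = 2 - 2 * cos (geodesic_dist p q)"
proof -
  have "(dist p q)\<^sup>2 = p \<bullet> p + q \<bullet> q - 2 * (p \<bullet> q)"
    unfolding dist_norm power2_norm_eq_inner by (simp add: algebra_simps inner_commute)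
  moreover have "p \<bullet> p = 1" "q \<bullet> q = 1"
    using assms by (simp_all add: dot_square_norm)
  ultimately show ?thesis
    using S2_inner_bounds[OF assms] by (simp add: geodesic_dist_def cos_arccos)
qed

text \<open>This translates the hypothesis and the conclusion of the theorem, both stated
  geodesically, to the Euclidean topology in which the limit arguments run.\<close>

lemma tendsto_S2_iff_geodesic_dist:
  assumes p: "\<And>k. p k \<in> S2" and q: "q \<in> S2"
  shows "p \<longlonglongrightarrow> q \<longleftrightarrow> (\<lambda>k. geodesic_dist (p k) q) \<longlonglongrightarrow> 0"
proof
  assume "p \<longlonglongrightarrow> q"
  then have "(\<lambda>k. (p k, q)) \<longlonglongrightarrow> (q, q)"
    by (intro tendsto_intros)
  from continuous_on_tendsto_compose[OF continuous_on_geodesic_dist this]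
  have "(\<lambda>k. geodesic_dist (p k) q) \<longlonglongrightarrow> geodesic_dist q q"
    using p q by auto
  also have "geodesic_dist q q = 0"
    using q by (simp add: geodesic_dist_def dot_square_norm)
  finally show "(\<lambda>k. geodesic_dist (p k) q) \<longlonglongrightarrow> 0" .
next
  assume "(\<lambda>k. geodesic_dist (p k) q) \<longlonglongrightarrow> 0"
  then have "(\<lambda>k. sqrt (2 - 2 * cos (geodesic_dist (p k) q))) \<longlonglongrightarrow> sqrt (2 - 2 * cos 0)"
    by (intro tendsto_intros)
  moreover have "sqrt (2 - 2 * cos (geodesic_dist (p k) q)) = dist (p k) q" for k
    by (metis dist_S2_conv_geodesic_dist p q real_sqrt_unique zero_le_dist)
  ultimately show "p \<longlonglongrightarrow> q"
    unfolding tendsto_dist_iff[of p] by simp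
qed

section \<open>Configurations as tuples\<close>

text \<open>Sets of varying cardinality become tuples over the fixed index set
  \<open>{1..n}\<close>, which can be compared entry by entry and to which compactness
  applies.\<close>

lemma config_iff_tuple:
  assumes "n \<ge> 1"
  shows "config n Q \<longleftrightarrow> (\<exists>t. t ` {1..n} \<subseteq> S2 \<and> lists_config n t Q)"
proof
  assume Q: "config n Q"
  then have fin: "finite Q" and card: "1 \<le> card Q" "card Q \<le> n" and sub: "Q \<subseteq> S2"
    by (auto simp: config_def)
  from fin obtain h where h: "bij_betw h {1..card Q} Q"
    using bij_betw_iff_card[of "{1..card Q}" Q] by auto
  \<comment> \<open>Capping the index at \<open>card Q\<close> pads the enumeration \<open>h\<close>
    by repeating its last point.\<close>
  have "(\<lambda>j. min j (card Q)) ` {1..n} = {1..card Q}"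
  proof (intro equalityI subsetI)
    fix i assume "i \<in> {1..card Q}"
    then have "i = min i (card Q)" "i \<in> {1..n}"
      using card by auto
    then show "i \<in> (\<lambda>j. min j (card Q)) ` {1..n}"
      by (rule image_eqI)
  qed (use card in auto)
  then have "(\<lambda>j. h (min j (card Q))) ` {1..n} = Q"
    using h by (metis bij_betw_imp_surj_on image_image)
  then show "\<exists>t. t ` {1..n} \<subseteq> S2 \<and> lists_config n t Q"
    using sub by (intro exI[of _ "\<lambda>j. h (min j (card Q))"]) (simp add: lists_config_def)
next
  assume "\<exists>t. t ` {1..n} \<subseteq> S2 \<and> lists_config n t Q"
  then obtain t where t: "t ` {1..n} \<subseteq> S2" "Q = t ` {1..n}"
    by (auto simp: lists_config_def)
  then have "finite Q" "Q \<noteq> {}" "card Q \<le> n"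
    using assms card_image_le[of "{1..n}" t] by auto
  moreover from this have "1 \<le> card Q"
    by (simp add: Suc_le_eq card_gt_0_iff)
  ultimately show "config n Q"
    using t by (simp add: config_def)
qed

lemma opt_distortion_tuples:
  assumes "n \<ge> 1"
  shows "opt_distortion n P = (INF t\<in>{t. t ` {1..n} \<subseteq> S2}. distortion P (t ` {1..n}))"
proof -
  have "{distortion P Q | Q. config n Q}
      = (\<lambda>t. distortion P (t ` {1..n})) ` {t. t ` {1..n} \<subseteq> S2}"
    by (auto simp: config_iff_tuple[OF assms] lists_config_def)
  then show ?thesis
    by (simp add: opt_distortion_def)
qed

text \<open>Taking the minimum over indices instead of points lets minima for two different tuples
  be compared by \<open>Min_image_diff_le\<close>, even when entries coincide.\<close>

lemma distortion_empirical_tuple: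
  assumes "M \<ge> 1"
  shows "distortion (empirical M x) (t ` J)
    = 1 / real M * (\<Sum>i=1..M. Min ((\<lambda>j. (geodesic_dist (x i) (t j))\<^sup>2) ` J))"
  by (simp only: distortion_empirical[OF assms] image_image)

lemma distortion_nonneg:
  fixes M n :: nat
  assumes "M \<ge> 1" "n \<ge> 1"
  shows "0 \<le> distortion (empirical M x) (t ` {1..n})"
  unfolding distortion_empirical_tuple[OF assms(1)]
  using assms by (intro mult_nonneg_nonneg sum_nonneg Min.boundedI) auto

section \<open>Continuity of the distortion and of its optimal value\<close>

text \<open>The point is the order of quantifiers: \<open>d\<close> is fixed before samples and
  centres. An error of at most \<open>e\<close> in each squared distance passes to the minima and
  then to their average.\<close>

lemma distortion_uniformly_continuous:
  fixes M n :: nat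
  assumes "M \<ge> 1" "n \<ge> 1" "e > 0"
  obtains d where "d > 0"
    "\<And>x y t u. \<lbrakk>x ` {1..M} \<subseteq> S2; y ` {1..M} \<subseteq> S2; t ` {1..n} \<subseteq> S2; u ` {1..n} \<subseteq> S2;
       \<And>i. i \<in> {1..M} \<Longrightarrow> dist (x i) (y i) < d; \<And>j. j \<in> {1..n} \<Longrightarrow> dist (t j) (u j) < d\<rbrakk>
     \<Longrightarrow> \<bar>distortion (empirical M x) (t ` {1..n}) - distortion (empirical M y) (u ` {1..n})\<bar> \<le> e"
proof -
  have "continuous_on (S2 \<times> S2) (\<lambda>z. (geodesic_dist (fst z) (snd z))\<^sup>2)"
    using continuous_on_geodesic_dist by (intro continuous_intros) (simp add: case_prod_beta)
  then have "uniformly_continuous_on (S2 \<times> S2) (\<lambda>z. (geodesic_dist (fst z) (snd z))\<^sup>2)"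
    by (intro compact_uniformly_continuous compact_Times compact_sphere)
  then obtain d where "d > 0" and d: "\<And>z w. \<lbrakk>z \<in> S2 \<times> S2; w \<in> S2 \<times> S2; dist w z < d\<rbrakk>
      \<Longrightarrow> dist ((geodesic_dist (fst w) (snd w))\<^sup>2) ((geodesic_dist (fst z) (snd z))\<^sup>2) < e"
    using \<open>e > 0\<close> unfolding uniformly_continuous_on_def by metis
  show thesis
  \<comment> \<open>Half of \<open>d\<close>, because the distance of two pairs is at most the sum
    of the two coordinate distances.\<close>
  proof (rule that[of "d / 2"])
    show "d / 2 > 0"
      using \<open>d > 0\<close> by simp
  next
    fix x y t u :: "nat \<Rightarrow> real ^ 3"
    assume S: "x ` {1..M} \<subseteq> S2" "y ` {1..M} \<subseteq> S2" "t ` {1..n} \<subseteq> S2" "u ` {1..n} \<subseteq> S2"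
      and xy: "\<And>i. i \<in> {1..M} \<Longrightarrow> dist (x i) (y i) < d / 2"
      and tu: "\<And>j. j \<in> {1..n} \<Longrightarrow> dist (t j) (u j) < d / 2"
    define mx where "mx i = Min ((\<lambda>j. (geodesic_dist (x i) (t j))\<^sup>2) ` {1..n})" for i
    define my where "my i = Min ((\<lambda>j. (geodesic_dist (y i) (u j))\<^sup>2) ` {1..n})" for i
    have close: "\<bar>mx i - my i\<bar> \<le> e" if i: "i \<in> {1..M}" for i
      unfolding mx_def my_def
    proof (rule Min_image_diff_le)
      fix j assume j: "j \<in> {1..n}"
      have "dist (x i, t j) (y i, u j) \<le> dist (x i) (y i) + dist (t j) (u j)"
        unfolding dist_Pair_Pair by (rule sqrt_sum_squares_le_sum) auto
      then have "dist (x i, t j) (y i, u j) < d"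
        using xy[OF i] tu[OF j] by linarith
      moreover have "(x i, t j) \<in> S2 \<times> S2" "(y i, u j) \<in> S2 \<times> S2"
        using S i j by blast+
      ultimately show "\<bar>(geodesic_dist (x i) (t j))\<^sup>2 - (geodesic_dist (y i) (u j))\<^sup>2\<bar> \<le> e"
        using d[of "(y i, u j)" "(x i, t j)"] by (simp add: dist_real_def)
    qed (use assms in auto)
    have "\<bar>(\<Sum>i=1..M. mx i) - (\<Sum>i=1..M. my i)\<bar> \<le> (\<Sum>i=1..M. \<bar>mx i - my i\<bar>)"
      unfolding sum_subtractf[symmetric] by (rule sum_abs)
    also have "\<dots> \<le> real M * e"
      using sum_bounded_above[of "{1..M}" "\<lambda>i. \<bar>mx i - my i\<bar>" e] close by simp
    finally have "\<bar>(\<Sum>i=1..M. mx i) - (\<Sum>i=1..M. my i)\<bar> / real M \<le> e"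
      using assms(1) by (simp add: field_simps)
    moreover have "\<bar>1 / real M * a - 1 / real M * b\<bar> = \<bar>a - b\<bar> / real M" for a b
      by (simp add: diff_divide_distrib[symmetric])
    ultimately show
      "\<bar>distortion (empirical M x) (t ` {1..n}) - distortion (empirical M y) (u ` {1..n})\<bar> \<le> e"
      unfolding distortion_empirical_tuple[OF assms(1)] mx_def my_def by simp
  qed
qed

lemma tendsto_distortion:
  fixes M n :: nat
  assumes "M \<ge> 1" "n \<ge> 1"
    and "\<And>k. xs k ` {1..M} \<subseteq> S2" "x ` {1..M} \<subseteq> S2" "\<And>k. t k ` {1..n} \<subseteq> S2" "l ` {1..n} \<subseteq> S2"
    and x: "\<And>i. i \<in> {1..M} \<Longrightarrow> (\<lambda>k. xs k i) \<longlonglongrightarrow> x i"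
    and l: "\<And>j. j \<in> {1..n} \<Longrightarrow> (\<lambda>k. t k j) \<longlonglongrightarrow> l j"
  shows "(\<lambda>k. distortion (empirical M (xs k)) (t k ` {1..n}))
    \<longlonglongrightarrow> distortion (empirical M x) (l ` {1..n})"
proof (rule tendstoI)
  fix e :: real assume "e > 0"
  \<comment> \<open>Uniform continuity yields a non-strict bound; using \<open>e / 2\<close> makes
    it strictly smaller than \<open>e\<close>.\<close>
  then have "e / 2 > 0"
    by simp
  from distortion_uniformly_continuous[OF assms(1,2) this] obtain d where "d > 0"
    and d: "\<And>x y t u. \<lbrakk>x ` {1..M} \<subseteq> S2; y ` {1..M} \<subseteq> S2; t ` {1..n} \<subseteq> S2; u ` {1..n} \<subseteq> S2;
       \<And>i. i \<in> {1..M} \<Longrightarrow> dist (x i) (y i) < d; \<And>j. j \<in> {1..n} \<Longrightarrow> dist (t j) (u j) < d\<rbrakk>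
     \<Longrightarrow> \<bar>distortion (empirical M x) (t ` {1..n}) - distortion (empirical M y) (u ` {1..n})\<bar> \<le> e / 2"
    by blast
  have "\<forall>\<^sub>F k in sequentially. \<forall>i\<in>{1..M}. dist (xs k i) (x i) < d"
    using x \<open>d > 0\<close> by (intro eventually_ball_finite ballI tendstoD) auto
  moreover have "\<forall>\<^sub>F k in sequentially. \<forall>j\<in>{1..n}. dist (t k j) (l j) < d"
    using l \<open>d > 0\<close> by (intro eventually_ball_finite ballI tendstoD) auto
  ultimately show "\<forall>\<^sub>F k in sequentially. dist (distortion (empirical M (xs k)) (t k ` {1..n}))
      (distortion (empirical M x) (l ` {1..n})) < e"
  proof eventually_elim
    case (elim k)
    then show ?case
      using d[of "xs k" x "t k" l] assms(3-6) \<open>e > 0\<close> by (auto simp: dist_real_def)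
  qed
qed

lemma tendsto_opt_distortion:
  fixes M n :: nat
  assumes "M \<ge> 1" "n \<ge> 1"
    and "\<And>k. xs k ` {1..M} \<subseteq> S2" "x ` {1..M} \<subseteq> S2"
    and x: "\<And>i. i \<in> {1..M} \<Longrightarrow> (\<lambda>k. xs k i) \<longlonglongrightarrow> x i"
  shows "(\<lambda>k. opt_distortion n (empirical M (xs k))) \<longlonglongrightarrow> opt_distortion n (empirical M x)"
proof (rule tendstoI)
  fix e :: real assume "e > 0"
  then have "e / 2 > 0"
    by simp
  from distortion_uniformly_continuous[OF assms(1,2) this] obtain d where "d > 0"
    and d: "\<And>x y t u. \<lbrakk>x ` {1..M} \<subseteq> S2; y ` {1..M} \<subseteq> S2; t ` {1..n} \<subseteq> S2; u ` {1..n} \<subseteq> S2;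
       \<And>i. i \<in> {1..M} \<Longrightarrow> dist (x i) (y i) < d; \<And>j. j \<in> {1..n} \<Longrightarrow> dist (t j) (u j) < d\<rbrakk>
     \<Longrightarrow> \<bar>distortion (empirical M x) (t ` {1..n}) - distortion (empirical M y) (u ` {1..n})\<bar> \<le> e / 2"
    by blast
  have bdd: "bdd_below ((\<lambda>t. distortion (empirical M y) (t ` {1..n})) ` A)" for y A
    using distortion_nonneg[OF assms(1,2)] by (intro bdd_belowI2)
  \<comment> \<open>Any point of the sphere would do: a constant tuple shows that the infimum ranges
    over a nonempty set.\<close>
  have "axis 1 1 \<in> S2"
    by simp
  then have ne: "{t. t ` {1..n} \<subseteq> S2} \<noteq> {}"
    by (auto intro!: exI[of _ "\<lambda>_. axis 1 1"])
  have "\<forall>\<^sub>F k in sequentially. \<forall>i\<in>{1..M}. dist (xs k i) (x i) < d"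
    using x \<open>d > 0\<close> by (intro eventually_ball_finite ballI tendstoD) auto
  then show "\<forall>\<^sub>F k in sequentially.
      dist (opt_distortion n (empirical M (xs k))) (opt_distortion n (empirical M x)) < e"
  proof eventually_elim
    case (elim k)
    \<comment> \<open>Only the sample moves: \<open>d\<close> is applied with the same tuple of
      centres on both sides, at distance zero from itself.\<close>
    have "\<bar>opt_distortion n (empirical M (xs k)) - opt_distortion n (empirical M x)\<bar> \<le> e / 2"
      unfolding opt_distortion_tuples[OF assms(2)]
      by (rule cINF_diff_le[OF ne bdd bdd]) (use d assms(3,4) elim \<open>d > 0\<close> in simp)
    then show ?case
      using \<open>e > 0\<close> by (simp add: dist_real_def)
  qed
qed

theorem corollary5p5:
  fixes M n :: nat
    and xs :: "nat \<Rightarrow> nat \<Rightarrow> real ^ 3"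
    and x :: "nat \<Rightarrow> real ^ 3"
  assumes "M \<ge> 1" and "n \<ge> 1"
    and "\<And>m i. i \<in> {1..M} \<Longrightarrow> xs m i \<in> S2"
    and "\<And>i. i \<in> {1..M} \<Longrightarrow> x i \<in> S2"
    and "(\<lambda>m. Max ((\<lambda>i. geodesic_dist (xs m i) (x i)) ` {1..M})) \<longlonglongrightarrow> 0"
  shows "((\<lambda>m. opt_distortion n (empirical M (xs m)))
           \<longlonglongrightarrow> opt_distortion n (empirical M x))
    \<and> (\<forall>Qs. (\<forall>m. optimal_n_means n (empirical M (xs m)) (Qs m)) \<longrightarrow>
           (\<exists>t r l. (\<forall>m. lists_config n (t m) (Qs m)) \<and> strict_mono r \<and>
              tuple_converges n (\<lambda>k. t (r k)) l \<and>
              optimal_n_means n (empirical M x) (l ` {1..n})))"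
proof -
  have S: "xs k ` {1..M} \<subseteq> S2" "x ` {1..M} \<subseteq> S2" for k
    using assms(3,4) by blast+
  have lim_x: "(\<lambda>k. xs k i) \<longlonglongrightarrow> x i" if i: "i \<in> {1..M}" for i
  proof -
    \<comment> \<open>Each distance is squeezed between 0 and the maximum, which tends to 0 by
      hypothesis.\<close>
    have "(\<lambda>k. geodesic_dist (xs k i) (x i)) \<longlonglongrightarrow> 0"
    proof (rule tendsto_sandwich[OF _ _ tendsto_const assms(5)])
      show "\<forall>\<^sub>F k in sequentially. 0 \<le> geodesic_dist (xs k i) (x i)"
        using geodesic_dist_nonneg assms(3,4) i by (intro always_eventually) blast
      show "\<forall>\<^sub>F k in sequentially. geodesic_dist (xs k i) (x i)
          \<le> Max ((\<lambda>i. geodesic_dist (xs k i) (x i)) ` {1..M})"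
        using i by (intro always_eventually allI Max_ge) auto
    qed
    then show ?thesis
      using tendsto_S2_iff_geodesic_dist[of "\<lambda>k. xs k i" "x i"] assms(3,4) i by blast
  qed
  have opt: "(\<lambda>k. opt_distortion n (empirical M (xs k))) \<longlonglongrightarrow> opt_distortion n (empirical M x)"
    using tendsto_opt_distortion[OF assms(1,2) S lim_x] .
  moreover have "\<exists>t r l. (\<forall>m. lists_config n (t m) (Qs m)) \<and> strict_mono r \<and>
      tuple_converges n (\<lambda>k. t (r k)) l \<and> optimal_n_means n (empirical M x) (l ` {1..n})"
    if Qs: "\<forall>m. optimal_n_means n (empirical M (xs m)) (Qs m)" for Qs
  proof -
    \<comment> \<open>An ordering of every optimal set is fixed before any subsequence is
      extracted.\<close>
    have "\<forall>m. \<exists>t. t ` {1..n} \<subseteq> S2 \<and> lists_config n t (Qs m)"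
      using Qs config_iff_tuple[OF assms(2)] unfolding optimal_n_means_def by blast
    then obtain t where t: "\<And>m. t m ` {1..n} \<subseteq> S2" "\<And>m. lists_config n (t m) (Qs m)"
      by metis
    have "\<exists>r l. strict_mono r \<and> (\<forall>j\<in>{1..n}. l j \<in> S2 \<and> (\<lambda>k. t (r k) j) \<longlonglongrightarrow> l j)"
      using t(1) by (intro seq_compact_finite_family compact_imp_seq_compact compact_sphere) blast+
    then obtain r l where r: "strict_mono r"
      and l: "\<And>j. j \<in> {1..n} \<Longrightarrow> l j \<in> S2" "\<And>j. j \<in> {1..n} \<Longrightarrow> (\<lambda>k. t (r k) j) \<longlonglongrightarrow> l j"
      by blast
    have lS: "l ` {1..n} \<subseteq> S2"
      using l(1) by blast
    have "tuple_converges n (\<lambda>k. t (r k)) l"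
      unfolding tuple_converges_def
    proof (intro ballI conjI)
      fix j assume j: "j \<in> {1..n}"
      have "\<And>k. t (r k) j \<in> S2"
        using t(1) j by blast
      then show "(\<lambda>k. geodesic_dist (t (r k) j) (l j)) \<longlonglongrightarrow> 0"
        using tendsto_S2_iff_geodesic_dist[of "\<lambda>k. t (r k) j" "l j"] l j by blast
    qed (rule l)
    \<comment> \<open>The optimal distortions along \<open>r\<close> have two limits: one by joint
      continuity in sample and centres, the other by convergence of the optimal values.\<close>
    moreover have "distortion (empirical M x) (l ` {1..n}) = opt_distortion n (empirical M x)"
    proof (rule LIMSEQ_unique)
      show "(\<lambda>k. distortion (empirical M (xs (r k))) (t (r k) ` {1..n}))
          \<longlonglongrightarrow> distortion (empirical M x) (l ` {1..n})"
        using S t(1) lS l(2) LIMSEQ_subseq_LIMSEQ[OF lim_x r]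
        by (intro tendsto_distortion assms(1,2)) (auto simp: o_def)
      have "distortion (empirical M (xs m)) (t m ` {1..n}) = opt_distortion n (empirical M (xs m))"
        for m
        using Qs t(2)[of m] by (simp add: optimal_n_means_def lists_config_def)
      then show "(\<lambda>k. distortion (empirical M (xs (r k))) (t (r k) ` {1..n}))
          \<longlonglongrightarrow> opt_distortion n (empirical M x)"
        using LIMSEQ_subseq_LIMSEQ[OF opt r] by (simp add: o_def)
    qed
    moreover have "config n (l ` {1..n})"
      unfolding config_iff_tuple[OF assms(2)] lists_config_def
      using lS by (intro exI[of _ l] conjI refl)
    ultimately show ?thesis
      using t(2) r unfolding optimal_n_means_def by blast
  qed
  ultimately show ?thesis
    by blast
qed

end
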